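(* Let $\sigma>0$ and $\nu>0$, and let $(h_0,v_0)\in H^1(0,1)\times L^2(0,1)$ with $h_0\geqslant 0$ and $M:=\int_0^1 h_0\,dx>0$. Let $(h,v)$ be a solution, in the sense described in the context, with $h\geqslant 0$ for all times, of the viscous sheet system $$v_t+vv_x=\sigma h_{xxx}+\frac{\nu}{h}\,(h v_x)_x,\qquad h_t=-(hv)_x,\qquad x\in(0,1),\ t>0,$$ with boundary conditions $h_x(0,t)=h_x(1,t)=v(0,t)=v(1,t)=0$ and initial conditions $h(x,0)=h_0(x)$, $v(x,0)=v_0(x)$. Then there exist positive constants $A,B$, depending on the initial data and on the parameters $\sigma,\nu$, such that $$\int_0^1 h_x^2(x,t)\,dx\leqslant A\,e^{-Bt}\qquad\text{for all } t\geqslant 0,$$ hence $$h(\cdot,t)\to M\quad\text{in } H^1(0,1)\cap C^{1/2}[0,1]\quad\text{as } t\to+\infty.$$ Moreover, $$v(\cdot,t)\to 0\quad\text{in } L^2(0,1)\quad\text{as } t\to\infty.$$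
   Context: Here $h(x,t)$ is the height of the sheet, $v(x,t)$ its lateral velocity, $\sigma$ the surface tension and $\nu$ the viscosity (dimensionless parameters). Solutions are global-in-time, sufficiently regular ($(H^1,L^2)$ weak) solutions with non-negative height for which the following hold. (i) Mass conservation: $\int_0^1 h(x,t)\,dx=\int_0^1 h_0\,dx=M$ for all $t\geqslant 0$. (ii) The energy and entropy equalities. Set $G(h):=\nu\log h$ and $$E(v,h):=\tfrac12\int_0^1\{hv^2+\sigma h_x^2\}\,dx,\qquad S(v,h):=\tfrac12\int_0^1\{h\,(v+(G(h))_x)^2+\sigma h_x^2\}\,dx,$$ which are finite for the initial data $(v_0,h_0)$. Then, for $t>0$, $$\tfrac{d}{dt}S(v,h)+\nu\sigma\int_0^1 h_{xx}^2\,dx=0,\qquad \tfrac{d}{dt}E(v,h)+\nu\int_0^1 h v_x^2\,dx=0 .$$ *)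

theory Defs
  imports "HOL-Analysis.Analysis"
begin

section \<open>Function spaces on the unit interval\<close>

definition L2 :: "(real \<Rightarrow> real) \<Rightarrow> bool" where
  "L2 f \<longleftrightarrow> f \<in> borel_measurable (lebesgue_on {0..1}) \<and>
     (\<lambda>x. (f x)\<^sup>2) absolutely_integrable_on {0..1}"

definition L2_norm :: "(real \<Rightarrow> real) \<Rightarrow> real" where
  "L2_norm f = sqrt (integral {0..1} (\<lambda>x. (f x)\<^sup>2))"

definition test_fun :: "(real \<Rightarrow> real) \<Rightarrow> (real \<Rightarrow> real) \<Rightarrow> bool" where
  "test_fun \<phi> \<phi>' \<longleftrightarrow>
     (\<forall>x. (\<phi> has_real_derivative \<phi>' x) (at x)) \<and> continuous_on UNIV \<phi>' \<and>
     closure {x. \<phi> x \<noteq> 0} \<subseteq> {0<..<1}"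

text \<open>\<open>g\<close> is the weak derivative of \<open>f\<close> on \<open>(0,1)\<close>, tested, as in Brezis' textbook,
  against \<open>C\<^sup>1\<close> functions with compact support in \<open>(0,1)\<close>. Both functions are
  integrable, so this says \<open>f \<in> W\<^sup>1\<^sup>,\<^sup>1(0,1)\<close> with \<open>f' = g\<close>.\<close>

definition weak_deriv :: "(real \<Rightarrow> real) \<Rightarrow> (real \<Rightarrow> real) \<Rightarrow> bool" where
  "weak_deriv f g \<longleftrightarrow>
     f absolutely_integrable_on {0..1} \<and> g absolutely_integrable_on {0..1} \<and>
     (\<forall>\<phi> \<phi>'. test_fun \<phi> \<phi>' \<longrightarrow>
        integral {0..1} (\<lambda>x. f x * \<phi>' x) = - integral {0..1} (\<lambda>x. g x * \<phi> x))"

text \<open>\<open>f \<in> H\<^sup>1(0,1)\<close> with weak derivative \<open>g\<close>. An element of \<open>H\<^sup>1(0,1)\<close> is always taken in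
  its continuous representative on \<open>[0,1]\<close>, so that pointwise (boundary) values make sense;
  its derivative is only determined almost everywhere.\<close>

definition H1 :: "(real \<Rightarrow> real) \<Rightarrow> (real \<Rightarrow> real) \<Rightarrow> bool" where
  "H1 f g \<longleftrightarrow> continuous_on {0..1} f \<and> L2 f \<and> L2 g \<and> weak_deriv f g"

definition H1_norm :: "(real \<Rightarrow> real) \<Rightarrow> (real \<Rightarrow> real) \<Rightarrow> real" where
  "H1_norm f g = sqrt ((L2_norm f)\<^sup>2 + (L2_norm g)\<^sup>2)"

definition holder_quotients :: "real \<Rightarrow> (real \<Rightarrow> real) \<Rightarrow> real set" where
  "holder_quotients \<alpha> f =
     {\<bar>f x - f y\<bar> / \<bar>x - y\<bar> powr \<alpha> | x y. x \<in> {0..1} \<and> y \<in> {0..1} \<and> x \<noteq> y}"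

definition holder :: "real \<Rightarrow> (real \<Rightarrow> real) \<Rightarrow> bool" where
  "holder \<alpha> f \<longleftrightarrow> continuous_on {0..1} f \<and> bdd_above (holder_quotients \<alpha> f)"

definition holder_norm :: "real \<Rightarrow> (real \<Rightarrow> real) \<Rightarrow> real" where
  "holder_norm \<alpha> f = (SUP x\<in>{0..1}. \<bar>f x\<bar>) + Sup (holder_quotients \<alpha> f)"

section \<open>Energy and entropy\<close>

definition G :: "real \<Rightarrow> real \<Rightarrow> real" where
  "G \<nu> s = \<nu> * ln s"

definition energy_density ::
  "real \<Rightarrow> (real \<Rightarrow> real) \<Rightarrow> (real \<Rightarrow> real) \<Rightarrow> (real \<Rightarrow> real) \<Rightarrow> real \<Rightarrow> real" where
  "energy_density \<sigma> v h hx x = h x * (v x)\<^sup>2 + \<sigma> * (hx x)\<^sup>2"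

text \<open>\<open>(G(h))\<^sub>x\<close> is written by the chain rule as \<open>G'(h) h\<^sub>x\<close>. Where \<open>h\<close> vanishes, the value of
  this term is irrelevant because of the factor \<open>h\<close> in front of the square.\<close>

definition entropy_density ::
  "real \<Rightarrow> real \<Rightarrow> (real \<Rightarrow> real) \<Rightarrow> (real \<Rightarrow> real) \<Rightarrow> (real \<Rightarrow> real) \<Rightarrow> real \<Rightarrow> real" where
  "entropy_density \<sigma> \<nu> v h hx x =
     h x * (v x + deriv (G \<nu>) (h x) * hx x)\<^sup>2 + \<sigma> * (hx x)\<^sup>2"

definition energy ::
  "real \<Rightarrow> (real \<Rightarrow> real) \<Rightarrow> (real \<Rightarrow> real) \<Rightarrow> (real \<Rightarrow> real) \<Rightarrow> real" where
  "energy \<sigma> v h hx = 1/2 * integral {0..1} (energy_density \<sigma> v h hx)"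

definition entropy ::
  "real \<Rightarrow> real \<Rightarrow> (real \<Rightarrow> real) \<Rightarrow> (real \<Rightarrow> real) \<Rightarrow> (real \<Rightarrow> real) \<Rightarrow> real" where
  "entropy \<sigma> \<nu> v h hx = 1/2 * integral {0..1} (entropy_density \<sigma> \<nu> v h hx)"

text \<open>Integrals of functions that are not integrable are \<open>0\<close> by convention, hence finiteness of
  \<open>E\<close> and \<open>S\<close> is a separate requirement.\<close>

definition finite_energy_entropy ::
  "real \<Rightarrow> real \<Rightarrow> (real \<Rightarrow> real) \<Rightarrow> (real \<Rightarrow> real) \<Rightarrow> (real \<Rightarrow> real) \<Rightarrow> bool" where
  "finite_energy_entropy \<sigma> \<nu> v h hx \<longleftrightarrow>
     energy_density \<sigma> v h hx absolutely_integrable_on {0..1} \<and>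
     entropy_density \<sigma> \<nu> v h hx absolutely_integrable_on {0..1}"

section \<open>Solutions of the viscous sheet system\<close>

text \<open>Functions of time and space take the time argument first, so that \<open>h t\<close> is the profile
  at time \<open>t\<close>. Test functions may be nonzero at \<open>t = 0\<close>.\<close>

definition spacetime_test_fun ::
  "(real \<Rightarrow> real \<Rightarrow> real) \<Rightarrow> (real \<Rightarrow> real \<Rightarrow> real) \<Rightarrow> (real \<Rightarrow> real \<Rightarrow> real) \<Rightarrow> bool" where
  "spacetime_test_fun \<phi> \<phi>t \<phi>x \<longleftrightarrow>
     (\<forall>t x. ((\<lambda>s. \<phi> s x) has_real_derivative \<phi>t t x) (at t)) \<and>
     (\<forall>t x. (\<phi> t has_real_derivative \<phi>x t x) (at x)) \<and>
     continuous_on UNIV (\<lambda>(t, x). \<phi>t t x) \<and> continuous_on UNIV (\<lambda>(t, x). \<phi>x t x) \<and>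
     compact (closure {(t, x). \<phi> t x \<noteq> 0}) \<and>
     closure {(t, x). \<phi> t x \<noteq> 0} \<subseteq> UNIV \<times> {0<..<1}"

definition locally_integrable :: "(real \<Rightarrow> real \<Rightarrow> real) \<Rightarrow> bool" where
  "locally_integrable u \<longleftrightarrow>
     (\<forall>T>0. (\<lambda>(t, x). u t x) absolutely_integrable_on {0..T} \<times> {0..1})"

text \<open>
  Global \<open>(H\<^sup>1, L\<^sup>2)\<close> weak solutions with nonnegative height. The functions \<open>hx\<close>, \<open>hxx\<close>, \<open>vx\<close>
  are the weak space derivatives; for \<open>t > 0\<close> the second derivative of the height and the
  first derivative of the velocity exist, \<open>v(t)\<close> and \<open>hx(t)\<close> being continuous representatives.

  Since \<open>h\<close> may vanish, the momentum equation
  \<open>v\<^sub>t + v v\<^sub>x = \<sigma> h\<^sub>x\<^sub>x\<^sub>x + (\<nu>/h) (h v\<^sub>x)\<^sub>x\<close> is multiplied by \<open>h\<close> and, using \<open>h\<^sub>t = - (h v)\<^sub>x\<close>, put into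
  the form \<open>(h v)\<^sub>t + (h v\<^sup>2)\<^sub>x = \<sigma> h h\<^sub>x\<^sub>x\<^sub>x + \<nu> (h v\<^sub>x)\<^sub>x\<close> before it is tested with \<open>\<phi>\<close>; the
  capillary term becomes \<open>- \<sigma> h\<^sub>x\<^sub>x (h \<phi>)\<^sub>x\<close> after one integration by parts.
\<close>

locale viscous_sheet_solution =
  fixes \<sigma> \<nu> :: real and h0 v0 :: "real \<Rightarrow> real"
    and h hx hxx v vx :: "real \<Rightarrow> real \<Rightarrow> real"
  assumes h_nonneg: "\<And>t x. t \<ge> 0 \<Longrightarrow> x \<in> {0..1} \<Longrightarrow> h t x \<ge> 0"
    and h_H1: "\<And>t. t \<ge> 0 \<Longrightarrow> H1 (h t) (hx t)"
    and v_L2: "\<And>t. t \<ge> 0 \<Longrightarrow> L2 (v t)"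
    and hx_H1: "\<And>t. t > 0 \<Longrightarrow> H1 (hx t) (hxx t)"
    and v_cont: "\<And>t. t > 0 \<Longrightarrow> continuous_on {0..1} (v t)"
    and v_weak_deriv: "\<And>t. t > 0 \<Longrightarrow> weak_deriv (v t) (vx t)"
    and dissipation_finite: "\<And>t. t > 0 \<Longrightarrow>
          (\<lambda>x. h t x * (vx t x)\<^sup>2) absolutely_integrable_on {0..1}"
    and boundary_h: "\<And>t. t > 0 \<Longrightarrow> hx t 0 = 0 \<and> hx t 1 = 0"
    and boundary_v: "\<And>t. t > 0 \<Longrightarrow> v t 0 = 0 \<and> v t 1 = 0"
    and initial_h: "\<And>x. x \<in> {0..1} \<Longrightarrow> h 0 x = h0 x"
    and initial_v: "AE x in lebesgue_on {0..1}. v 0 x = v0 x"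
    and fluxes_integrable:
      "locally_integrable h"
      "locally_integrable (\<lambda>t x. h t x * v t x)"
      "locally_integrable (\<lambda>t x. h t x * (v t x)\<^sup>2)"
      "locally_integrable (\<lambda>t x. hxx t x * hx t x)"
      "locally_integrable (\<lambda>t x. hxx t x * h t x)"
      "locally_integrable (\<lambda>t x. h t x * vx t x)"
    and mass_equation: "\<And>\<phi> \<phi>t \<phi>x. spacetime_test_fun \<phi> \<phi>t \<phi>x \<Longrightarrow>
          integral ({0..} \<times> {0..1}) (\<lambda>(t, x). h t x * \<phi>t t x + h t x * v t x * \<phi>x t x)
          + integral {0..1} (\<lambda>x. h0 x * \<phi> 0 x) = 0"
    and momentum_equation: "\<And>\<phi> \<phi>t \<phi>x. spacetime_test_fun \<phi> \<phi>t \<phi>x \<Longrightarrow>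
          integral ({0..} \<times> {0..1})
            (\<lambda>(t, x). h t x * v t x * \<phi>t t x + h t x * (v t x)\<^sup>2 * \<phi>x t x
                      - \<sigma> * hxx t x * (hx t x * \<phi> t x + h t x * \<phi>x t x)
                      - \<nu> * h t x * vx t x * \<phi>x t x)
          + integral {0..1} (\<lambda>x. h0 x * v0 x * \<phi> 0 x) = 0"
    and mass_conservation: "\<And>t. t \<ge> 0 \<Longrightarrow> integral {0..1} (h t) = integral {0..1} h0"
    and energy_entropy_finite: "\<And>t. t \<ge> 0 \<Longrightarrow> finite_energy_entropy \<sigma> \<nu> (v t) (h t) (hx t)"
    and entropy_continuous: "continuous_on {0..} (\<lambda>t. entropy \<sigma> \<nu> (v t) (h t) (hx t))"
    and energy_continuous: "continuous_on {0..} (\<lambda>t. energy \<sigma> (v t) (h t) (hx t))"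
    and entropy_equality: "\<And>t. t > 0 \<Longrightarrow>
          ((\<lambda>t. entropy \<sigma> \<nu> (v t) (h t) (hx t)) has_real_derivative
             - (\<nu> * \<sigma> * integral {0..1} (\<lambda>x. (hxx t x)\<^sup>2))) (at t)"
    and energy_equality: "\<And>t. t > 0 \<Longrightarrow>
          ((\<lambda>t. energy \<sigma> (v t) (h t) (hx t)) has_real_derivative
             - (\<nu> * integral {0..1} (\<lambda>x. h t x * (vx t x)\<^sup>2))) (at t)"

end

theory Submission imports Defs begin

text \<open>
  The sum \<open>F = E + S\<close> of energy and entropy satisfies \<open>F' = - \<nu> W - \<nu>\<sigma> D\<close> with
  \<open>W = \<integral> h v\<^sub>x\<^sup>2\<close> and \<open>D = \<integral> h\<^sub>x\<^sub>x\<^sup>2\<close>. Since \<open>h\<^sub>x\<close> vanishes at the boundary and \<open>h\<close> has mean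
  \<open>M\<close>, the height differs from \<open>M\<close> by at most \<open>\<surd>D\<close>. Whenever \<open>\<surd>D \<le> M/2\<close>, the sheet is
  therefore uniformly thick, \<open>M/2 \<le> h \<le> 3M/2\<close>, the weight \<open>h\<close> in the dissipation is harmless,
  and Poincare type estimates bound \<open>F\<close> by a multiple of \<open>W + D\<close>
  (\<open>energy_entropy_le_dissipation\<close>), so that \<open>F' \<le> - c F\<close>.

  At the other times \<open>h\<close> may vanish and no weighted Poincare inequality is available. But then
  \<open>D > (M/2)\<^sup>2\<close>, so \<open>S\<close> decreases at least at the fixed rate \<open>d = \<nu>\<sigma> (M/2)\<^sup>2\<close>. As
  \<open>S \<ge> 0\<close>, this can go on only for a total time of at most \<open>S(0) / d\<close>. The functional
  \<open>F exp ((c/d) S)\<close> makes this quantitative without measuring the set of bad times: it decreases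
  at least at the exponential rate \<open>c\<close> throughout (\<open>gated_exponential_decay\<close>). Hence
  \<open>E(t) \<le> F(0) exp ((c/d) S(0)) exp (- c t)\<close>.

  The energy controls \<open>\<integral> h\<^sub>x\<^sup>2\<close>, which in turn controls \<open>h - M\<close> in \<open>H\<^sup>1\<close> and in
  \<open>C\<^sup>1\<^sup>/\<^sup>2\<close>. Once \<open>h \<ge> M/2\<close>, the energy also controls \<open>v\<close> in \<open>L\<^sup>2\<close>.

  The constants must not depend on the solution. They are expressed by \<open>E(0)\<close> and \<open>S(0)\<close>, which
  are determined by \<open>h\<^sub>0\<close> and \<open>v\<^sub>0\<close> because weak derivatives are unique almost everywhere
  (\<open>weak_deriv_unique\<close>). All pointwise estimates rest on the fundamental theorem of calculus for
  weak derivatives (\<open>weak_deriv_increment\<close>), which is obtained by testing with smoothed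
  trapezoids.
\<close>

section \<open>The fundamental theorem of calculus for weak derivatives\<close>

lemma has_real_derivative_pos_part_sq:
  "((\<lambda>y::real. (max 0 y)\<^sup>2) has_real_derivative 2 * max 0 y) (at y)"
proof -
  consider "y > 0" | "y < 0" | "y = 0" by linarith
  then show ?thesis
  proof cases
    case 1
    have "((\<lambda>y::real. y\<^sup>2) has_real_derivative 2 * max 0 y) (at y)"
      using 1 by (auto intro!: derivative_eq_intros)
    then show ?thesis
      by (rule has_field_derivative_transform_within_open[where S="{0<..}"]) (use 1 in auto)
  next
    case 2
    have "((\<lambda>y::real. 0) has_real_derivative 2 * max 0 y) (at y)"
      using 2 by (auto intro!: derivative_eq_intros)
    then show ?thesis
      by (rule has_field_derivative_transform_within_open[where S="{..<0}"]) (use 2 in auto)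
  next
    case 3
    have "((\<lambda>k::real. (max 0 k)\<^sup>2 / k) \<longlongrightarrow> 0) (at 0)"
    proof (rule Lim_null_comparison)
      show "\<forall>\<^sub>F k::real in at 0. norm ((max 0 k)\<^sup>2 / k) \<le> \<bar>k\<bar>"
        by (rule always_eventually) (auto simp: max_def power2_eq_square)
      show "((\<lambda>k::real. \<bar>k\<bar>) \<longlongrightarrow> 0) (at 0)"
        by (rule tendsto_rabs_zero) auto
    qed
    then show ?thesis
      using 3 by (simp add: DERIV_def)
  qed
qed

text \<open>The primitive of \<open>tent\<close>: a quadratic spline rising from \<open>0\<close> to \<open>1\<close> on \<open>[0,1]\<close>. The
  truncated squares make it \<open>C\<^sup>1\<close> without any matching conditions at the nodes.\<close>

definition smooth_step :: "real \<Rightarrow> real" where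
  "smooth_step y = 2 * ((max 0 y)\<^sup>2 - 2 * (max 0 (y - 1/2))\<^sup>2 + (max 0 (y - 1))\<^sup>2)"

text \<open>The hat function of integral \<open>1\<close> supported in \<open>[0,1]\<close>, with peak \<open>2\<close> at \<open>1/2\<close>.\<close>

definition tent :: "real \<Rightarrow> real" where
  "tent y = 4 * (max 0 y - 2 * max 0 (y - 1/2) + max 0 (y - 1))"

lemma has_real_derivative_smooth_step:
  "(smooth_step has_real_derivative tent y) (at y)"
proof -
  have shift: "((\<lambda>y. (max 0 (y - c))\<^sup>2) has_real_derivative 2 * max 0 (y - c)) (at y)" for c :: real
  proof -
    have "((\<lambda>y. y - c) has_real_derivative 1) (at y)"
      by (auto intro!: derivative_eq_intros)
    from DERIV_chain2[where g = "\<lambda>y. y - c", OF has_real_derivative_pos_part_sq this]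
    show ?thesis by simp
  qed
  show ?thesis
    unfolding smooth_step_def tent_def
    by (rule derivative_eq_intros shift has_real_derivative_pos_part_sq refl)+ simp
qed

lemma continuous_on_tent [continuous_intros]:
  "continuous_on A f \<Longrightarrow> continuous_on A (\<lambda>x. tent (f x))"
  unfolding tent_def by (intro continuous_intros)

lemma tent_nonneg: "tent y \<ge> 0"
  by (auto simp: tent_def max_def)

lemma tent_eq_0: "y \<le> 0 \<or> y \<ge> 1 \<Longrightarrow> tent y = 0"
  by (auto simp: tent_def max_def)

lemma smooth_step_eq_0: "y \<le> 0 \<Longrightarrow> smooth_step y = 0"
  by (auto simp: smooth_step_def max_def)

lemma smooth_step_eq_1: "y \<ge> 1 \<Longrightarrow> smooth_step y = 1"
  by (auto simp: smooth_step_def max_def power2_eq_square algebra_simps)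

lemma smooth_step_mono: "x \<le> y \<Longrightarrow> smooth_step x \<le> smooth_step y"
  by (rule DERIV_nonneg_imp_nondecreasing)
     (use has_real_derivative_smooth_step tent_nonneg in blast)+

lemma smooth_step_bounds: "0 \<le> smooth_step y" "smooth_step y \<le> 1"
  using smooth_step_mono[of "min 0 y" y] smooth_step_mono[of y "max 1 y"]
  by (auto simp: smooth_step_eq_0 smooth_step_eq_1)

lemma has_real_derivative_scaled_step:
  "((\<lambda>x. smooth_step (k * (x - a))) has_real_derivative k * tent (k * (x - a))) (at x)"
proof -
  have "((\<lambda>x. k * (x - a)) has_real_derivative k) (at x)"
    by (auto intro!: derivative_eq_intros)
  from DERIV_chain2[where g = "\<lambda>x. k * (x - a)", OF has_real_derivative_smooth_step this]
  show ?thesis by (simp add: mult.commute)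
qed

lemma tent_kernel_integral:
  assumes "0 \<le> a" "k > 0" "a + 1 / k \<le> 1"
  shows "((\<lambda>x. k * tent (k * (x - a))) has_integral 1) {0..1}"
proof -
  have "((\<lambda>x. k * tent (k * (x - a))) has_integral
      smooth_step (k * (1 - a)) - smooth_step (k * (0 - a))) {0..1}"
    by (rule fundamental_theorem_of_calculus)
      (auto intro: has_field_derivative_at_within has_real_derivative_scaled_step
         simp flip: has_real_derivative_iff_has_vector_derivative)
  moreover have "k * (1 - a) \<ge> 1" using assms by (simp add: field_simps)
  ultimately show ?thesis
    using assms by (simp add: smooth_step_eq_0 smooth_step_eq_1)
qed

text \<open>The kernels \<open>n tent (n (x - a))\<close> are nonnegative, have integral \<open>1\<close> and concentrate on
  \<open>[a, a + 1/n]\<close>, so they form an approximate identity at \<open>a\<close> from the right. The bound \<open>a < 1\<close>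
  leaves room for this interval inside \<open>[0,1]\<close>.\<close>

lemma tent_kernel_limit:
  assumes f: "continuous_on {0..1} f" and a: "0 \<le> a" "a < 1"
  shows "(\<lambda>n. integral {0..1} (\<lambda>x. f x * (real n * tent (real n * (x - a))))) \<longlonglongrightarrow> f a"
proof (rule LIMSEQ_I)
  fix e :: real assume "e > 0"
  have "a \<in> {0..1}" using a by auto
  then obtain d where d: "d > 0" "\<And>x. x \<in> {0..1} \<Longrightarrow> dist x a < d \<Longrightarrow> dist (f x) (f a) < e / 2"
    using f \<open>e > 0\<close> unfolding continuous_on_iff by (metis half_gt_zero)
  obtain N :: nat where N: "N > 0" "1 / N < min d (1 - a)"
    using d(1) a(2) real_arch_inverse[of "min d (1 - a)"] by (auto simp: field_simps)
  have "norm (integral {0..1} (\<lambda>x. f x * (real n * tent (real n * (x - a)))) - f a) < e"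
    if "n \<ge> N" for n
  proof -
    define K where "K x = real n * tent (real n * (x - a))" for x
    have n: "real n > 0" "1 / n \<le> 1 / N" using that N by (auto intro: divide_left_mono)
    \<comment> \<open>As \<open>K\<close> has mass one, the error is the average of \<open>f - f a\<close> over an interval of length \<open>1/n < d\<close>.\<close>
    have K: "(K has_integral 1) {0..1}"
      unfolding K_def by (rule tent_kernel_integral) (use n N a in auto)
    have Kcont: "continuous_on {0..1} K"
      unfolding K_def by (intro continuous_intros)
    have fK: "(\<lambda>x. f x * K x) integrable_on {0..1}"
      by (intro integrable_continuous_real continuous_intros f Kcont)
    have "integral {0..1} (\<lambda>x. f x * K x) - f a = integral {0..1} (\<lambda>x. (f x - f a) * K x)"
      using K fK by (simp add: left_diff_distrib integral_diff has_integral_integrable integral_unique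
          integrable_on_mult_right)
    also have "norm \<dots> \<le> integral {0..1} (\<lambda>x. e / 2 * K x)"
    proof (rule integral_norm_bound_integral)
      show "(\<lambda>x. (f x - f a) * K x) integrable_on {0..1}"
        by (intro integrable_continuous_real continuous_intros f Kcont)
      show "(\<lambda>x. e / 2 * K x) integrable_on {0..1}"
        by (intro integrable_continuous_real continuous_intros Kcont)
      fix x :: real assume x: "x \<in> {0..1}"
      show "norm ((f x - f a) * K x) \<le> e / 2 * K x"
      proof (cases "a \<le> x \<and> x \<le> a + 1 / n")
        case True
        then have "dist x a < d" using n N by (auto simp: dist_real_def)
        with d(2)[OF x] have "\<bar>f x - f a\<bar> \<le> e / 2" by (simp add: dist_real_def)
        moreover have "K x \<ge> 0" by (simp add: K_def tent_nonneg)
        ultimately have "\<bar>f x - f a\<bar> * K x \<le> e / 2 * K x" by (rule mult_right_mono)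
        then show ?thesis using \<open>K x \<ge> 0\<close> by (simp add: abs_mult)
      next
        case False
        then have "real n * (x - a) \<le> 0 \<or> real n * (x - a) \<ge> 1"
          using n by (auto simp: field_simps mult_le_0_iff)
        then have "K x = 0" by (auto simp: K_def tent_eq_0)
        then show ?thesis by simp
      qed
    qed
    also have "\<dots> = e / 2" using K by (simp add: integral_unique)
    finally show ?thesis using \<open>e > 0\<close> by (simp add: K_def)
  qed
  then show "\<exists>no. \<forall>n\<ge>no. norm (integral {0..1} (\<lambda>x. f x * (real n * tent (real n * (x - a)))) - f a) < e"
    by blast
qed

text \<open>These functions rise from \<open>0\<close> to \<open>1\<close> after \<open>a\<close> and fall back to \<open>0\<close> after \<open>b\<close>; as \<open>k\<close> grows,
  they approximate the indicator of \<open>(a,b]\<close>, while their derivatives approximate the difference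
  of the point masses at \<open>a\<close> and \<open>b\<close>.\<close>

lemma test_fun_trapezoid:
  assumes "0 < a" "a \<le> b" "k > 0" "b + 1 / k < 1"
  shows "test_fun (\<lambda>x. smooth_step (k * (x - a)) - smooth_step (k * (x - b)))
                  (\<lambda>x. k * tent (k * (x - a)) - k * tent (k * (x - b)))"
  unfolding test_fun_def
proof (intro conjI allI)
  show "((\<lambda>x. smooth_step (k * (x - a)) - smooth_step (k * (x - b))) has_real_derivative
      k * tent (k * (x - a)) - k * tent (k * (x - b))) (at x)" for x
    by (intro DERIV_diff has_real_derivative_scaled_step)
  show "continuous_on UNIV (\<lambda>x. k * tent (k * (x - a)) - k * tent (k * (x - b)))"
    by (intro continuous_intros)
  have "closure {x. smooth_step (k * (x - a)) - smooth_step (k * (x - b)) \<noteq> 0} \<subseteq> {a..b + 1 / k}"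
  proof (rule closure_minimal)
    show "{x. smooth_step (k * (x - a)) - smooth_step (k * (x - b)) \<noteq> 0} \<subseteq> {a..b + 1 / k}"
    proof (rule subsetI, rule ccontr)
      fix x assume x: "x \<in> {x. smooth_step (k * (x - a)) - smooth_step (k * (x - b)) \<noteq> 0}"
        and "x \<notin> {a..b + 1 / k}"
      then consider "x < a" | "x > b + 1 / k" by force
      then show False
      proof cases
        case 1
        then have "k * (x - a) \<le> 0" "k * (x - b) \<le> 0"
          using assms by (auto simp: mult_le_0_iff)
        then show ?thesis using x by (simp add: smooth_step_eq_0)
      next
        case 2
        then have "k * (x - b) \<ge> 1" using assms by (simp add: field_simps)
        moreover from this have "k * (x - a) \<ge> 1"
          using assms by (smt (verit) mult_left_mono)
        ultimately show ?thesis using x by (simp add: smooth_step_eq_1)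
      qed
    qed
  qed auto
  also have "\<dots> \<subseteq> {0<..<1}" using assms by auto
  finally show "closure {x. smooth_step (k * (x - a)) - smooth_step (k * (x - b)) \<noteq> 0} \<subseteq> {0<..<1}" .
qed

lemma scaled_step_limit:
  "(\<lambda>n. smooth_step (real n * (x - a))) \<longlonglongrightarrow> (if x > a then 1 else 0)"
proof (cases "x > a")
  case True
  obtain N :: nat where "real N * (x - a) \<ge> 1"
    using True reals_Archimedean3[of "x - a"] by (metis diff_gt_0_iff_gt less_imp_le)
  then have "smooth_step (real n * (x - a)) = 1" if "n \<ge> N" for n
    using True that by (intro smooth_step_eq_1) (smt (verit) mult_right_mono of_nat_mono)
  then have "\<forall>\<^sub>F n in sequentially. smooth_step (real n * (x - a)) = 1"
    by (auto simp: eventually_sequentially)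
  then show ?thesis using True by (simp add: tendsto_eventually)
next
  case False
  then have "smooth_step (real n * (x - a)) = 0" for n
    by (intro smooth_step_eq_0) (simp add: mult_nonneg_nonpos)
  then show ?thesis using False by simp
qed

text \<open>Test the weak derivative with the trapezoids between \<open>a\<close> and \<open>b\<close>. On one side, dominated
  convergence produces the integral of \<open>g\<close> over \<open>(a,b]\<close>; on the other side, continuity of \<open>f\<close>
  produces \<open>f b - f a\<close>.\<close>

lemma weak_deriv_increment_interior:
  assumes f: "continuous_on {0..1} f" and w: "weak_deriv f g"
    and ab: "0 < a" "a \<le> b" "b < 1"
  shows "integral {a..b} g = f b - f a"
proof -
  define \<phi> where "\<phi> n x = smooth_step (real n * (x - a)) - smooth_step (real n * (x - b))" for n :: nat and x
  define K where "K n c x = real n * tent (real n * (x - c))" for n :: nat and c x :: real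
  have g: "g absolutely_integrable_on {0..1}" using w by (simp add: weak_deriv_def)
  have \<phi>_cont: "continuous_on A (\<phi> n)" for n A
    unfolding \<phi>_def
    by (rule DERIV_continuous_on, rule has_field_derivative_at_within)
      (rule DERIV_diff has_real_derivative_scaled_step)+
  have \<phi>_bound: "\<bar>\<phi> n x\<bar> \<le> 1" for n x
    unfolding \<phi>_def using smooth_step_bounds[of "real n * (x - a)"] smooth_step_bounds[of "real n * (x - b)"]
    by linarith
  have lim_g: "(\<lambda>n. integral {0..1} (\<lambda>x. g x * \<phi> n x)) \<longlonglongrightarrow>
      integral {0..1} (\<lambda>x. if x \<in> {a<..b} then g x else 0)"
  proof (rule dominated_convergence)
    show "(\<lambda>x. g x * \<phi> n x) integrable_on {0..1}" for n
    proof -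
      have "(\<lambda>x. \<phi> n x * g x) absolutely_integrable_on {0..1}"
      proof (rule absolutely_integrable_bounded_measurable_product_real[OF _ _ _ g])
        show "\<phi> n \<in> borel_measurable (lebesgue_on {0..1})"
          by (rule continuous_imp_measurable_on_sets_lebesgue) (auto intro: \<phi>_cont)
        show "bounded (\<phi> n ` {0..1})"
          using \<phi>_bound by (auto simp: bounded_iff)
      qed auto
      then show ?thesis
        by (simp add: absolutely_integrable_on_def mult.commute)
    qed
    show "(\<lambda>x. \<bar>g x\<bar>) integrable_on {0..1}"
      using g by (simp add: absolutely_integrable_on_def)
    show "norm (g x * \<phi> n x) \<le> \<bar>g x\<bar>" for n x
      using \<phi>_bound[of n x] by (simp add: abs_mult mult_left_le)
    show "(\<lambda>n. g x * \<phi> n x) \<longlonglongrightarrow> (if x \<in> {a<..b} then g x else 0)" for x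
    proof -
      have "(\<lambda>n. g x * \<phi> n x) \<longlonglongrightarrow> g x * ((if x > a then 1 else 0) - (if x > b then 1 else 0))"
        unfolding \<phi>_def by (intro tendsto_intros scaled_step_limit)
      also have "g x * ((if x > a then 1 else 0) - (if x > b then 1 else 0))
          = (if x \<in> {a<..b} then g x else 0)"
        using ab by auto
      finally show ?thesis .
    qed
  qed
  have lim_f: "(\<lambda>n. - (integral {0..1} (\<lambda>x. f x * K n a x) - integral {0..1} (\<lambda>x. f x * K n b x)))
      \<longlonglongrightarrow> - (f a - f b)"
    unfolding K_def by (intro tendsto_intros tent_kernel_limit f) (use ab in auto)
  have "\<forall>\<^sub>F n in sequentially. - (integral {0..1} (\<lambda>x. f x * K n a x) - integral {0..1} (\<lambda>x. f x * K n b x))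
      = integral {0..1} (\<lambda>x. g x * \<phi> n x)"
  proof -
    obtain N :: nat where N: "N > 0" "1 / N < 1 - b"
      using ab(3) real_arch_inverse[of "1 - b"] by (auto simp: field_simps)
    have "- (integral {0..1} (\<lambda>x. f x * K n a x) - integral {0..1} (\<lambda>x. f x * K n b x))
      = integral {0..1} (\<lambda>x. g x * \<phi> n x)" if "n \<ge> N" for n
    proof -
      have n: "real n > 0" "1 / n \<le> 1 / N" using that N by (auto intro: divide_left_mono)
      have "test_fun (\<phi> n) (\<lambda>x. K n a x - K n b x)"
        unfolding \<phi>_def K_def by (rule test_fun_trapezoid) (use n N ab in auto)
      then have "integral {0..1} (\<lambda>x. f x * (K n a x - K n b x)) = - integral {0..1} (\<lambda>x. g x * \<phi> n x)"
        using w by (simp add: weak_deriv_def)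
      moreover have "integral {0..1} (\<lambda>x. f x * (K n a x - K n b x)) =
          integral {0..1} (\<lambda>x. f x * K n a x) - integral {0..1} (\<lambda>x. f x * K n b x)"
        unfolding right_diff_distrib K_def
        by (rule integral_diff) (intro integrable_continuous_real continuous_intros f)+
      ultimately show ?thesis by simp
    qed
    then show ?thesis by (auto simp: eventually_sequentially)
  qed
  with lim_f have "(\<lambda>n. integral {0..1} (\<lambda>x. g x * \<phi> n x)) \<longlonglongrightarrow> - (f a - f b)"
    by (rule Lim_transform_eventually)
  with lim_g have "integral {0..1} (\<lambda>x. if x \<in> {a<..b} then g x else 0) = f b - f a"
    using LIMSEQ_unique by fastforce
  also have "integral {0..1} (\<lambda>x. if x \<in> {a<..b} then g x else 0) = integral ({a<..b} \<inter> {0..1}) g"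
    by (rule integral_restrict_Int)
  also have "\<dots> = integral {a<..b} g"
    using ab by (intro arg_cong2[where f=integral]) auto
  also have "\<dots> = integral {a..b} g"
    by (rule integral_spike_set; rule negligible_subset[of "{a}"]) auto
  finally show ?thesis .
qed

text \<open>Both sides are continuous in the end points, so the formula extends from the open interval to
  its closure.\<close>

lemma weak_deriv_increment:
  assumes f: "continuous_on {0..1} f" and w: "weak_deriv f g"
    and ab: "0 \<le> a" "a \<le> b" "b \<le> 1"
  shows "integral {a..b} g = f b - f a"
proof -
  have g: "g integrable_on {0..1}"
    using w by (simp add: weak_deriv_def absolutely_integrable_on_def)
  define D where "D x = integral {0..x} g - f x" for x
  have D_cont: "continuous_on {0..1} D"
    unfolding D_def by (rule continuous_on_diff[OF indefinite_integral_continuous_1[OF g] f])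
  have eq: "integral {0..x} g + integral {x..y} g = integral {0..y} g"
    if "0 \<le> x" "x \<le> y" "y \<le> 1" for x y
    using that
    by (intro Henstock_Kurzweil_Integration.integral_combine) (auto intro: integrable_on_subinterval[OF g])
  have "D constant_on {0..1}"
  proof -
    have "D constant_on closure {0<..<1}"
    proof (rule constant_on_closureI)
      show "continuous_on (closure {0<..<1}) D" using D_cont by simp
    next
      have D_eq: "D x = D y" if "0 < x" "x \<le> y" "y < 1" for x y
        using weak_deriv_increment_interior[OF f w that] eq[of x y] that by (simp add: D_def)
      have "D x = D (1/2)" if "x \<in> {0<..<1}" for x
        using D_eq[of x "1/2"] D_eq[of "1/2" x] that by (cases "x \<le> 1/2") auto
      then show "D constant_on {0<..<1}" unfolding constant_on_def by blast
    qed
    then show ?thesis by simp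
  qed
  then have "D a = D b" using ab by (auto simp: constant_on_def)
  then show ?thesis using eq[of a b] ab by (simp add: D_def)
qed

text \<open>The two derivatives have the same integral over every subinterval, and an integrable function is
  almost everywhere the limit of its averages over shrinking intervals.\<close>

lemma weak_deriv_unique:
  assumes f: "continuous_on {0..1} f" and w1: "weak_deriv f g1" and w2: "weak_deriv f g2"
  obtains N where "negligible N" "\<And>x. x \<in> {0..1} - N \<Longrightarrow> g1 x = g2 x"
proof -
  have g: "g1 integrable_on {0..1}" "g2 integrable_on {0..1}"
    using w1 w2 by (simp_all add: weak_deriv_def absolutely_integrable_on_def)
  define G where "G x = (if x \<in> {0..1} then g1 x - g2 x else 0)" for x
  have int: "G integrable_on cbox a b" for a b
  proof -
    have "(\<lambda>x. g1 x - g2 x) integrable_on {0..1}" using g by (rule integrable_diff)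
    then have "G integrable_on UNIV" unfolding G_def by (rule integrable_restrict_UNIV[THEN iffD2])
    then show ?thesis by (rule integrable_on_subcbox) auto
  qed
  obtain N where N: "negligible N"
    "\<And>x e. \<lbrakk>x \<notin> N; 0 < e\<rbrakk> \<Longrightarrow> \<exists>d>0. \<forall>h. 0 < h \<and> h < d \<longrightarrow>
        norm (integral (cbox x (x + h *\<^sub>R One)) G /\<^sub>R h ^ DIM(real) - G x) < e"
    using integrable_ccontinuous_explicit[OF int] by metis
  have "G x = 0" if x: "x \<notin> N" "0 \<le> x" "x < 1" for x
  proof (rule ccontr)
    assume "G x \<noteq> 0"
    then obtain d where d: "d > 0" "\<And>h. 0 < h \<Longrightarrow> h < d \<Longrightarrow>
        norm (integral (cbox x (x + h *\<^sub>R One)) G /\<^sub>R h ^ DIM(real) - G x) < \<bar>G x\<bar>"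
      using N(2)[OF x(1), of "\<bar>G x\<bar>"] by auto
    define h where "h = min (d / 2) (1 - x)"
    have h: "h > 0" "h < d" "x + h \<le> 1" using d x by (auto simp: h_def)
    have "integral {x..x + h} G = integral {x..x + h} (\<lambda>y. g1 y - g2 y)"
      by (rule integral_cong) (use x h in \<open>auto simp: G_def\<close>)
    also have "\<dots> = integral {x..x + h} g1 - integral {x..x + h} g2"
      by (rule integral_diff; rule integrable_on_subinterval[OF g(1)] integrable_on_subinterval[OF g(2)])
        (use x h in auto)
    also have "\<dots> = 0"
      using x h by (simp add: weak_deriv_increment[OF f w1] weak_deriv_increment[OF f w2])
    finally show False using d(2)[OF h(1,2)] by simp
  qed
  then have "g1 x = g2 x" if "x \<in> {0..1} - insert 1 N" for x
    using that by (auto simp: G_def split: if_splits)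
  then show ?thesis using N(1) by (intro that[of "insert 1 N"]) auto
qed

section \<open>Estimates by the weak derivative\<close>

text \<open>Jensen's inequality for the square: the variance of \<open>g\<close>, whose mean is \<open>m\<close> below, is
  nonnegative.\<close>

lemma integral_square_le:
  fixes g :: "real \<Rightarrow> real"
  assumes "a \<le> b" "g integrable_on {a..b}" "(\<lambda>x. (g x)\<^sup>2) integrable_on {a..b}"
  shows "(integral {a..b} g)\<^sup>2 \<le> (b - a) * integral {a..b} (\<lambda>x. (g x)\<^sup>2)"
proof (cases "a = b")
  case False
  define I where "I = integral {a..b} g"
  define m where "m = I / (b - a)"
  have ab: "b - a > 0" using False assms(1) by simp
  have "(\<lambda>x. (g x)\<^sup>2 - 2 * m * g x + m\<^sup>2) integrable_on {a..b}"
    using assms by (intro integrable_add integrable_diff integrable_on_mult_right integrable_const_ivl)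
  then have "0 \<le> integral {a..b} (\<lambda>x. (g x)\<^sup>2 - 2 * m * g x + m\<^sup>2)"
  proof (rule integral_nonneg)
    fix x
    have "(g x)\<^sup>2 - 2 * m * g x + m\<^sup>2 = (g x - m)\<^sup>2" by (simp add: power2_eq_square algebra_simps)
    then show "0 \<le> (g x)\<^sup>2 - 2 * m * g x + m\<^sup>2" by simp
  qed
  also have "\<dots> = integral {a..b} (\<lambda>x. (g x)\<^sup>2 - 2 * m * g x) + integral {a..b} (\<lambda>x. m\<^sup>2)"
    by (rule integral_add) (use assms in \<open>auto intro!: integrable_diff integrable_on_mult_right\<close>)
  also have "integral {a..b} (\<lambda>x. (g x)\<^sup>2 - 2 * m * g x)
      = integral {a..b} (\<lambda>x. (g x)\<^sup>2) - integral {a..b} (\<lambda>x. 2 * m * g x)"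
    by (rule integral_diff) (use assms in \<open>auto intro!: integrable_on_mult_right\<close>)
  also have "integral {a..b} (\<lambda>x. 2 * m * g x) = 2 * m * I" by (simp add: I_def)
  also have "integral {a..b} (\<lambda>x. m\<^sup>2) = m\<^sup>2 * (b - a)" using assms(1) by simp
  finally have "2 * m * I - m\<^sup>2 * (b - a) \<le> integral {a..b} (\<lambda>x. (g x)\<^sup>2)" by linarith
  moreover have "2 * m * I - m\<^sup>2 * (b - a) = I\<^sup>2 / (b - a)"
  proof -
    have "m * (b - a) = I" using ab by (simp add: m_def)
    then have "m\<^sup>2 * (b - a) = m * I" by (simp add: power2_eq_square mult.assoc)
    then show ?thesis by (simp add: m_def power2_eq_square)
  qed
  ultimately have "I\<^sup>2 / (b - a) \<le> integral {a..b} (\<lambda>x. (g x)\<^sup>2)" by linarith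
  then show ?thesis
    using ab by (simp add: I_def pos_divide_le_eq mult.commute)
qed auto

lemma weak_deriv_increment_sq_le:
  assumes f: "continuous_on {0..1} f" and w: "weak_deriv f g"
    and sq: "(\<lambda>x. (g x)\<^sup>2) integrable_on {0..1}"
    and xy: "x \<in> {0..1}" "y \<in> {0..1}"
  shows "(f y - f x)\<^sup>2 \<le> \<bar>y - x\<bar> * integral {0..1} (\<lambda>z. (g z)\<^sup>2)"
proof -
  have *: "(f y - f x)\<^sup>2 \<le> (y - x) * integral {0..1} (\<lambda>z. (g z)\<^sup>2)"
    if xy: "0 \<le> x" "x \<le> y" "y \<le> 1" for x y
  proof -
    have sub: "{x..y} \<subseteq> {0..1}" using xy by auto
    have g: "g integrable_on {0..1}"
      using w by (simp add: weak_deriv_def absolutely_integrable_on_def)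
    have "(f y - f x)\<^sup>2 = (integral {x..y} g)\<^sup>2"
      using weak_deriv_increment[OF f w xy] by simp
    also have "\<dots> \<le> (y - x) * integral {x..y} (\<lambda>z. (g z)\<^sup>2)"
      by (intro integral_square_le integrable_on_subinterval[OF g sub]
          integrable_on_subinterval[OF sq sub] xy(2))
    also have "\<dots> \<le> (y - x) * integral {0..1} (\<lambda>z. (g z)\<^sup>2)"
      using xy sub by (intro mult_left_mono integral_subset_le integrable_on_subinterval[OF sq sub] sq) auto
    finally show ?thesis .
  qed
  show ?thesis
    using *[of x y] *[of y x] xy by (cases "x \<le> y") (auto simp: power2_commute)
qed

lemma weak_deriv_oscillation:
  assumes "continuous_on {0..1} f" "weak_deriv f g" "(\<lambda>x. (g x)\<^sup>2) integrable_on {0..1}"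
    and xy: "x \<in> {0..1}" "y \<in> {0..1}"
  shows "(f y - f x)\<^sup>2 \<le> integral {0..1} (\<lambda>z. (g z)\<^sup>2)"
proof -
  have "(f y - f x)\<^sup>2 \<le> \<bar>y - x\<bar> * integral {0..1} (\<lambda>z. (g z)\<^sup>2)"
    by (rule weak_deriv_increment_sq_le[OF assms])
  also have "\<dots> \<le> 1 * integral {0..1} (\<lambda>z. (g z)\<^sup>2)"
    using xy by (intro mult_right_mono integral_nonneg assms(3)) auto
  finally show ?thesis by simp
qed

text \<open>The deviation from the mean is the mean of the increments.\<close>

lemma deviation_from_mean:
  fixes f :: "real \<Rightarrow> real"
  assumes f: "continuous_on {0..1} f" and m: "integral {0..1} f = m"
    and osc: "\<And>x y. x \<in> {0..1} \<Longrightarrow> y \<in> {0..1} \<Longrightarrow> (f y - f x)\<^sup>2 \<le> Q"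
    and x: "x \<in> {0..1}"
  shows "\<bar>f x - m\<bar> \<le> sqrt Q"
proof -
  have int: "f integrable_on {0..1}" using f by (rule integrable_continuous_real)
  have "m - f x = integral {0..1} (\<lambda>y. f y - f x)"
    using m int by (subst integral_diff) auto
  also have "norm \<dots> \<le> integral {0..1} (\<lambda>y::real. sqrt Q)"
    by (rule integral_norm_bound_integral)
      (use int osc[OF x] in \<open>auto intro!: integrable_diff real_le_rsqrt\<close>)
  also have "\<dots> = sqrt Q" by simp
  finally show ?thesis by (simp add: abs_minus_commute)
qed

text \<open>The bounds that express the embedding of \<open>H\<^sup>1(0,1)\<close> into \<open>C\<^sup>1\<^sup>/\<^sup>2[0,1]\<close>: by the Cauchy-Schwarz inequality an
  increment over length \<open>l\<close> is at most \<open>\<surd>(l Q)\<close>.\<close>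

lemma holder_half_bounds:
  assumes f: "continuous_on {0..1} f" and w: "weak_deriv f g"
    and sq: "(\<lambda>x. (g x)\<^sup>2) integrable_on {0..1}"
  defines "Q \<equiv> integral {0..1} (\<lambda>x. (g x)\<^sup>2)"
  assumes m: "integral {0..1} f = m"
  shows "holder (1/2) f" "0 \<le> holder_norm (1/2) (\<lambda>x. f x - m)"
    "holder_norm (1/2) (\<lambda>x. f x - m) \<le> 2 * sqrt Q"
proof -
  have quot: "0 \<le> q \<and> q \<le> sqrt Q" if "q \<in> holder_quotients (1/2) f" for q
  proof -
    from that obtain x y where xy: "x \<in> {0..1}" "y \<in> {0..1}" "x \<noteq> y"
      "q = \<bar>f x - f y\<bar> / \<bar>x - y\<bar> powr (1/2)"
      by (auto simp: holder_quotients_def)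
    have "\<bar>f x - f y\<bar> \<le> sqrt (\<bar>x - y\<bar> * Q)"
      using weak_deriv_increment_sq_le[OF f w sq xy(2,1)] unfolding Q_def by (auto intro: real_le_rsqrt)
    then have "\<bar>f x - f y\<bar> \<le> sqrt Q * sqrt \<bar>x - y\<bar>"
      by (simp add: real_sqrt_mult mult.commute)
    then show ?thesis
      using xy by (simp add: powr_half_sqrt pos_divide_le_eq)
  qed
  have ne: "\<bar>f 0 - f 1\<bar> / \<bar>0 - 1\<bar> powr (1/2) \<in> holder_quotients (1/2) f"
    unfolding holder_quotients_def by (intro CollectI exI[of _ 0] exI[of _ 1]) auto
  have bdd: "bdd_above (holder_quotients (1/2) f)"
    using quot by (meson bdd_aboveI)
  then show "holder (1/2) f"
    using f by (simp add: holder_def)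
  have shift: "holder_quotients (1/2) (\<lambda>x. f x - m) = holder_quotients (1/2) f"
    by (simp add: holder_quotients_def)
  have dev: "\<bar>f x - m\<bar> \<le> sqrt Q" if "x \<in> {0..1}" for x
    using deviation_from_mean[OF f m _ that] weak_deriv_oscillation[OF f w sq] unfolding Q_def by blast
  have sup_le: "(SUP x\<in>{0..1}. \<bar>f x - m\<bar>) \<le> sqrt Q"
    by (rule cSUP_least) (use dev in auto)
  have "bdd_above ((\<lambda>x. \<bar>f x - m\<bar>) ` {0..1})"
    by (rule bdd_aboveI2) (rule dev)
  then have "\<bar>f 0 - m\<bar> \<le> (SUP x\<in>{0..1}. \<bar>f x - m\<bar>)"
    by (rule cSUP_upper[rotated]) simp
  then have sup: "0 \<le> (SUP x\<in>{0..1}. \<bar>f x - m\<bar>)" by (rule order_trans[OF abs_ge_zero])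
  have Sup_le: "Sup (holder_quotients (1/2) f) \<le> sqrt Q"
    by (rule cSup_least) (use ne quot in blast)+
  have Sup: "0 \<le> Sup (holder_quotients (1/2) f)"
    using quot[OF ne] cSup_upper[OF ne bdd] by linarith
  show "0 \<le> holder_norm (1/2) (\<lambda>x. f x - m)" "holder_norm (1/2) (\<lambda>x. f x - m) \<le> 2 * sqrt Q"
    using sup sup_le Sup Sup_le by (simp_all add: holder_norm_def shift)
qed

lemma H1_norm_deviation_le:
  assumes f: "continuous_on {0..1} f" and w: "weak_deriv f g"
    and sq: "(\<lambda>x. (g x)\<^sup>2) integrable_on {0..1}" and m: "integral {0..1} f = m"
  shows "H1_norm (\<lambda>x. f x - m) g \<le> sqrt (2 * integral {0..1} (\<lambda>x. (g x)\<^sup>2))"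
proof -
  define Q where "Q = integral {0..1} (\<lambda>x. (g x)\<^sup>2)"
  have Q: "Q \<ge> 0" unfolding Q_def by (intro integral_nonneg sq) auto
  have pt: "(f x - m)\<^sup>2 \<le> Q" if "x \<in> {0..1}" for x
  proof -
    have "\<bar>f x - m\<bar> \<le> sqrt Q"
      using deviation_from_mean[OF f m _ that] weak_deriv_oscillation[OF f w sq] unfolding Q_def by blast
    then show ?thesis using Q by (metis abs_ge_zero power2_abs power_mono real_sqrt_pow2)
  qed
  have int: "(\<lambda>x. (f x - m)\<^sup>2) integrable_on {0..1}"
    by (intro integrable_continuous_real continuous_intros f)
  have "integral {0..1} (\<lambda>x. (f x - m)\<^sup>2) \<le> integral {0..1} (\<lambda>x::real. Q)"
    by (rule integral_le[OF int]) (use pt in auto)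
  then have le: "integral {0..1} (\<lambda>x. (f x - m)\<^sup>2) \<le> Q" by simp
  have "integral {0..1} (\<lambda>x. (f x - m)\<^sup>2) \<ge> 0" by (rule integral_nonneg[OF int]) auto
  then show ?thesis using le Q by (simp add: H1_norm_def L2_norm_def flip: Q_def)
qed

section \<open>Decay by two dissipation mechanisms\<close>

text \<open>At every time either \<open>F\<close> decays exponentially or the nonnegative quantity \<open>S\<close> is consumed at
  rate \<open>d\<close>. The weight \<open>exp ((c/d) S)\<close> contributes \<open>(c/d) S' \<le> - c\<close> to the logarithmic derivative
  at the times of the second kind, so \<open>F exp ((c/d) S)\<close> decays at rate \<open>c\<close> at all times. The
  price is the factor \<open>exp ((c/d) S(0))\<close>.\<close>

lemma gated_exponential_decay:
  fixes F S F' S' :: "real \<Rightarrow> real"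
  assumes cd: "c > 0" "d > 0"
    and cont: "continuous_on {0..} F" "continuous_on {0..} S"
    and F: "\<And>t. t > 0 \<Longrightarrow> (F has_real_derivative F' t) (at t)"
    and S: "\<And>t. t > 0 \<Longrightarrow> (S has_real_derivative S' t) (at t)"
    and nonneg: "\<And>t. t \<ge> 0 \<Longrightarrow> F t \<ge> 0" "\<And>t. t \<ge> 0 \<Longrightarrow> S t \<ge> 0"
    and dec: "\<And>t. t > 0 \<Longrightarrow> F' t \<le> 0" "\<And>t. t > 0 \<Longrightarrow> S' t \<le> 0"
    and gate: "\<And>t. t > 0 \<Longrightarrow> F' t \<le> - c * F t \<or> S' t \<le> - d"
    and t: "t \<ge> 0"
  shows "F t \<le> F 0 * exp (c / d * S 0) * exp (- c * t)"
proof -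
  define L where "L t = F t * exp (c / d * S t + c * t)" for t
  have "L t \<le> L 0"
  proof (rule DERIV_nonpos_imp_decreasing_open[OF t])
    show "continuous_on {0..t} L"
      unfolding L_def by (intro continuous_intros continuous_on_subset[OF cont(1)]
          continuous_on_subset[OF cont(2)]) (use cd in auto)
  next
    fix s assume s: "0 < s" "s < t"
    have "(L has_real_derivative
        (F' s + F s * (c / d * S' s + c)) * exp (c / d * S s + c * s)) (at s)"
      unfolding L_def by (rule derivative_eq_intros F S s refl)+ (simp add: algebra_simps)
    moreover have "F' s + F s * (c / d * S' s + c) \<le> 0"
      using gate[OF s(1)]
    proof
      assume "F' s \<le> - c * F s"
      moreover have "F s * (c / d * S' s) \<le> 0"
        using nonneg(1)[of s] dec(2)[of s] cd s by (intro mult_nonneg_nonpos) auto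
      ultimately show ?thesis by (simp add: algebra_simps)
    next
      assume "S' s \<le> - d"
      then have "c / d * S' s \<le> c / d * - d" using cd by (intro mult_left_mono) auto
      then have "c / d * S' s + c \<le> 0" using cd by simp
      then have "F s * (c / d * S' s + c) \<le> 0"
        using nonneg(1)[of s] s by (intro mult_nonneg_nonpos) auto
      then show ?thesis using dec(1)[OF s(1)] by linarith
    qed
    ultimately show "\<exists>y. (L has_real_derivative y) (at s) \<and> y \<le> 0"
      by (meson exp_ge_zero mult_nonpos_nonneg)
  qed
  moreover have "F t * exp (c * t) \<le> L t"
    unfolding L_def using nonneg[OF t] cd by (intro mult_left_mono) auto
  ultimately have "F t * exp (c * t) \<le> F 0 * exp (c / d * S 0)" by (simp add: L_def)
  then show ?thesis
    by (simp add: exp_minus field_simps)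
qed

section \<open>Energy and entropy of a single profile\<close>

lemma deriv_G: "s > 0 \<Longrightarrow> deriv (G \<nu>) s = \<nu> / s"
  unfolding G_def by (rule DERIV_imp_deriv) (auto intro!: derivative_eq_intros)

lemma energy_nonneg:
  assumes "\<sigma> > 0" "\<And>x. x \<in> {0..1} \<Longrightarrow> h x \<ge> 0" "finite_energy_entropy \<sigma> \<nu> v h hx"
  shows "energy \<sigma> v h hx \<ge> 0"
proof -
  have "energy_density \<sigma> v h hx integrable_on {0..1}"
    using assms(3) by (simp add: finite_energy_entropy_def absolutely_integrable_on_def)
  then have "integral {0..1} (energy_density \<sigma> v h hx) \<ge> 0"
    by (rule integral_nonneg) (use assms in \<open>auto simp: energy_density_def\<close>)
  then show ?thesis by (simp add: energy_def)
qed

lemma entropy_nonneg: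
  assumes "\<sigma> > 0" "\<And>x. x \<in> {0..1} \<Longrightarrow> h x \<ge> 0" "finite_energy_entropy \<sigma> \<nu> v h hx"
  shows "entropy \<sigma> \<nu> v h hx \<ge> 0"
proof -
  have "entropy_density \<sigma> \<nu> v h hx integrable_on {0..1}"
    using assms(3) by (simp add: finite_energy_entropy_def absolutely_integrable_on_def)
  then have "integral {0..1} (entropy_density \<sigma> \<nu> v h hx) \<ge> 0"
    by (rule integral_nonneg) (use assms in \<open>auto simp: entropy_density_def\<close>)
  then show ?thesis by (simp add: entropy_def)
qed

lemma energy_controls_slope:
  assumes "\<sigma> > 0" "\<And>x. x \<in> {0..1} \<Longrightarrow> h x \<ge> 0" "finite_energy_entropy \<sigma> \<nu> v h hx"
    and hx: "(\<lambda>x. (hx x)\<^sup>2) integrable_on {0..1}"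
  shows "integral {0..1} (\<lambda>x. (hx x)\<^sup>2) \<le> 2 / \<sigma> * energy \<sigma> v h hx"
proof -
  have int: "energy_density \<sigma> v h hx integrable_on {0..1}"
    using assms(3) by (simp add: finite_energy_entropy_def absolutely_integrable_on_def)
  have "integral {0..1} (\<lambda>x. \<sigma> * (hx x)\<^sup>2) \<le> integral {0..1} (energy_density \<sigma> v h hx)"
    by (rule integral_le[OF _ int])
      (use assms in \<open>auto simp: energy_density_def intro: integrable_on_mult_right\<close>)
  then show ?thesis
    using \<open>\<sigma> > 0\<close> by (simp add: energy_def field_simps)
qed

lemma energy_controls_velocity:
  assumes "\<sigma> > 0" "m > 0" and h: "\<And>x. x \<in> {0..1} \<Longrightarrow> h x \<ge> m"
    and fin: "finite_energy_entropy \<sigma> \<nu> v h hx"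
    and v: "(\<lambda>x. (v x)\<^sup>2) integrable_on {0..1}"
  shows "L2_norm v \<le> sqrt (2 / m * energy \<sigma> v h hx)"
proof -
  have int: "energy_density \<sigma> v h hx integrable_on {0..1}"
    using fin by (simp add: finite_energy_entropy_def absolutely_integrable_on_def)
  have "integral {0..1} (\<lambda>x. m * (v x)\<^sup>2) \<le> integral {0..1} (energy_density \<sigma> v h hx)"
  proof (rule integral_le[OF _ int])
    show "(\<lambda>x. m * (v x)\<^sup>2) integrable_on {0..1}" using v by (rule integrable_on_mult_right)
    fix x :: real assume "x \<in> {0..1}"
    then have "m * (v x)\<^sup>2 \<le> h x * (v x)\<^sup>2" using h by (intro mult_right_mono) auto
    then show "m * (v x)\<^sup>2 \<le> energy_density \<sigma> v h hx x"
      using \<open>\<sigma> > 0\<close> by (simp add: energy_density_def add_increasing2)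
  qed
  then show ?thesis
    using \<open>m > 0\<close> by (simp add: energy_def L2_norm_def field_simps)
qed

lemma energy_entropy_cong_AE:
  assumes N: "negligible N"
    and eq: "\<And>x. x \<in> {0..1} - N \<Longrightarrow> v x = v' x \<and> h x = h' x \<and> hx x = hx' x"
  shows "energy \<sigma> v h hx = energy \<sigma> v' h' hx'" "entropy \<sigma> \<nu> v h hx = entropy \<sigma> \<nu> v' h' hx'"
  unfolding energy_def entropy_def
  by (intro arg_cong[where f="\<lambda>I. 1/2 * I"] integral_spike[OF N];
      simp add: energy_density_def entropy_density_def eq)+

text \<open>Because \<open>h\<^sub>x\<close> and \<open>v\<close> vanish at \<open>0\<close>, the integrals \<open>D\<close> and \<open>W\<close> bound the functions themselves
  pointwise: \<open>h\<^sub>x\<^sup>2 \<le> D\<close> and, once \<open>h \<ge> M/2\<close>, \<open>v\<^sup>2 \<le> \<integral> v\<^sub>x\<^sup>2 \<le> 2W/M\<close>. The smallness of \<open>D\<close> keeps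
  \<open>h\<close> between \<open>M/2\<close> and \<open>3M/2\<close>, so that all terms of both densities are bounded by multiples
  of \<open>W\<close> and \<open>D\<close>. The cross term of the entropy is absorbed by \<open>(a + b)\<^sup>2 \<le> 2a\<^sup>2 + 2b\<^sup>2\<close>.\<close>

lemma energy_entropy_le_dissipation:
  assumes pos: "\<sigma> > 0" "M > 0"
    and h: "continuous_on {0..1} h" "weak_deriv h hx"
    and hx: "H1 hx hxx" "hx 0 = 0"
    and v: "continuous_on {0..1} v" "weak_deriv v vx" "v 0 = 0"
    and W_fin: "(\<lambda>x. h x * (vx x)\<^sup>2) absolutely_integrable_on {0..1}"
    and mass: "integral {0..1} h = M"
    and fin: "finite_energy_entropy \<sigma> \<nu> v h hx"
  defines "D \<equiv> integral {0..1} (\<lambda>x. (hxx x)\<^sup>2)"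
    and "W \<equiv> integral {0..1} (\<lambda>x. h x * (vx x)\<^sup>2)"
  assumes small: "D \<le> (M / 2)\<^sup>2"
  shows "energy \<sigma> v h hx + entropy \<sigma> \<nu> v h hx \<le> 9 / 2 * W + (2 * \<nu>\<^sup>2 / M + \<sigma>) * D"
proof -
  have hxx_int: "(\<lambda>x. (hxx x)\<^sup>2) integrable_on {0..1}"
    using hx(1) by (simp add: H1_def L2_def absolutely_integrable_on_def)
  have hx_cont: "continuous_on {0..1} hx" and hx_weak: "weak_deriv hx hxx"
    using hx(1) by (simp_all add: H1_def)
  have slope: "(hx x)\<^sup>2 \<le> D" if "x \<in> {0..1}" for x
    using weak_deriv_oscillation[OF hx_cont hx_weak hxx_int, of 0 x] that hx(2) by (simp add: D_def)
  have D: "D \<ge> 0" using slope[of 0] by (simp add: hx(2))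
  have hx_int: "(\<lambda>x. (hx x)\<^sup>2) integrable_on {0..1}"
    by (intro integrable_continuous_real continuous_intros hx_cont)
  have "integral {0..1} (\<lambda>x. (hx x)\<^sup>2) \<le> integral {0..1} (\<lambda>x::real. D)"
    by (rule integral_le[OF hx_int _ slope]) auto
  then have slope_int: "integral {0..1} (\<lambda>x. (hx x)\<^sup>2) \<le> D" by simp
  have height: "M / 2 \<le> h x" "h x \<le> 3 / 2 * M" if "x \<in> {0..1}" for x
  proof -
    have "\<bar>h x - M\<bar> \<le> sqrt D"
      using deviation_from_mean[OF h(1) mass _ that] weak_deriv_oscillation[OF h hx_int] slope_int
      by (meson order_trans)
    also have "sqrt D \<le> M / 2" using small pos by (intro real_le_lsqrt) auto
    finally show "M / 2 \<le> h x" "h x \<le> 3 / 2 * M" by linarith+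
  qed
  have h_nonneg: "h x \<ge> 0" if "x \<in> {0..1}" for x using height(1)[OF that] pos by linarith
  have W_int: "(\<lambda>x. h x * (vx x)\<^sup>2) integrable_on {0..1}"
    using W_fin by (simp add: absolutely_integrable_on_def)
  have vx_le: "(vx x)\<^sup>2 \<le> 2 / M * (h x * (vx x)\<^sup>2)" if "x \<in> {0..1}" for x
  proof -
    have "M / 2 * (vx x)\<^sup>2 \<le> h x * (vx x)\<^sup>2" using height[OF that] by (intro mult_right_mono) auto
    then show ?thesis using pos by (simp add: field_simps)
  qed
  \<comment> \<open>Only \<open>h v\<^sub>x\<^sup>2\<close> is known to be integrable; the lower bound on \<open>h\<close> removes the weight.\<close>
  have vx_int: "(\<lambda>x. (vx x)\<^sup>2) integrable_on {0..1}"
  proof (rule measurable_bounded_by_integrable_imp_integrable)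
    have "vx \<in> borel_measurable (lebesgue_on {0..1})"
      using v(2) by (intro absolutely_integrable_imp_borel_measurable) (auto simp: weak_deriv_def)
    then show "(\<lambda>x. (vx x)\<^sup>2) \<in> borel_measurable (lebesgue_on {0..1})" by measurable
    show "(\<lambda>x. 2 / M * (h x * (vx x)\<^sup>2)) integrable_on {0..1}"
      using W_int by (rule integrable_on_mult_right)
  qed (use vx_le in auto)
  have "integral {0..1} (\<lambda>x. (vx x)\<^sup>2) \<le> integral {0..1} (\<lambda>x. 2 / M * (h x * (vx x)\<^sup>2))"
    by (rule integral_le[OF vx_int integrable_on_mult_right[OF W_int] vx_le])
  then have vx_W: "integral {0..1} (\<lambda>x. (vx x)\<^sup>2) \<le> 2 / M * W" by (simp add: W_def)
  have velocity: "(v x)\<^sup>2 \<le> 2 / M * W" if "x \<in> {0..1}" for x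
    using weak_deriv_oscillation[OF v(1,2) vx_int, of 0 x] that v(3) vx_W by simp
  have kinetic: "h x * (v x)\<^sup>2 \<le> 3 * W" if "x \<in> {0..1}" for x
  proof -
    have "h x * (v x)\<^sup>2 \<le> (3 / 2 * M) * (2 / M * W)"
      using height[OF that] velocity[OF that] h_nonneg[OF that] pos by (intro mult_mono) auto
    then show ?thesis using pos by simp
  qed
  have energy_le: "energy_density \<sigma> v h hx x \<le> 3 * W + \<sigma> * D" if "x \<in> {0..1}" for x
    using kinetic[OF that] slope[OF that] pos by (simp add: energy_density_def add_mono)
  have entropy_le: "entropy_density \<sigma> \<nu> v h hx x \<le> 6 * W + 4 * \<nu>\<^sup>2 / M * D + \<sigma> * D"
    if x: "x \<in> {0..1}" for x
  proof -
    have hpos: "h x > 0" using height[OF x] pos by linarith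
    have "(\<nu> * hx x)\<^sup>2 / h x \<le> (\<nu>\<^sup>2 * D) / (M / 2)"
      using height[OF x] slope[OF x] pos D by (intro frac_le) (auto simp: power_mult_distrib intro: mult_left_mono)
    moreover have "h x * (v x + \<nu> / h x * hx x)\<^sup>2 \<le> 2 * (h x * (v x)\<^sup>2) + 2 * ((\<nu> * hx x)\<^sup>2 / h x)"
    proof -
      have "(v x + \<nu> / h x * hx x)\<^sup>2 \<le> 2 * (v x)\<^sup>2 + 2 * (\<nu> / h x * hx x)\<^sup>2"
        using sum_squares_bound[of "v x" "\<nu> / h x * hx x"] by (simp add: power2_sum)
      then have "h x * (v x + \<nu> / h x * hx x)\<^sup>2 \<le> h x * (2 * (v x)\<^sup>2 + 2 * (\<nu> / h x * hx x)\<^sup>2)"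
        using hpos by (intro mult_left_mono) auto
      also have "\<dots> = 2 * (h x * (v x)\<^sup>2) + 2 * ((\<nu> * hx x)\<^sup>2 / h x)"
        using hpos by (simp add: power2_eq_square field_simps)
      finally show ?thesis .
    qed
    moreover have "\<sigma> * (hx x)\<^sup>2 \<le> \<sigma> * D" using slope[OF x] pos by simp
    ultimately show ?thesis
      using kinetic[OF x] hpos by (simp add: entropy_density_def deriv_G)
  qed
  have "integral {0..1} (energy_density \<sigma> v h hx) \<le> integral {0..1} (\<lambda>x::real. 3 * W + \<sigma> * D)"
    by (rule integral_le) (use fin energy_le in \<open>auto simp: finite_energy_entropy_def absolutely_integrable_on_def\<close>)
  then have E: "integral {0..1} (energy_density \<sigma> v h hx) \<le> 3 * W + \<sigma> * D" by simp
  have "integral {0..1} (entropy_density \<sigma> \<nu> v h hx)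
      \<le> integral {0..1} (\<lambda>x::real. 6 * W + 4 * \<nu>\<^sup>2 / M * D + \<sigma> * D)"
    by (rule integral_le) (use fin entropy_le in \<open>auto simp: finite_energy_entropy_def absolutely_integrable_on_def\<close>)
  then have S: "integral {0..1} (entropy_density \<sigma> \<nu> v h hx) \<le> 6 * W + 2 * (2 * \<nu>\<^sup>2 / M * D) + \<sigma> * D"
    by simp
  show ?thesis
    unfolding energy_def entropy_def distrib_right using E S by linarith
qed

section \<open>Decay and convergence of solutions\<close>

context viscous_sheet_solution
begin

abbreviation E where "E t \<equiv> energy \<sigma> (v t) (h t) (hx t)"
abbreviation S where "S t \<equiv> entropy \<sigma> \<nu> (v t) (h t) (hx t)"

text \<open>The profile of a solution at time \<open>0\<close> agrees with the initial data almost everywhere. For the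
  slope, \<open>hx 0\<close> and \<open>h0x\<close> are both weak derivatives of \<open>h0\<close>. This makes the constants of the
  decay estimate independent of the solution.\<close>

lemma initial_energy_entropy:
  assumes h0: "H1 h0 h0x"
  shows "E 0 = energy \<sigma> v0 h0 h0x" "S 0 = entropy \<sigma> \<nu> v0 h0 h0x"
proof -
  have "integral {0..1} (\<lambda>x. h0 x * \<phi> x) = integral {0..1} (\<lambda>x. h 0 x * \<phi> x)" for \<phi>
    by (rule integral_cong) (simp add: initial_h)
  moreover have "h0 absolutely_integrable_on {0..1}" "continuous_on {0..1} h0"
    using h0 by (simp_all add: H1_def weak_deriv_def)
  ultimately have w: "weak_deriv h0 (hx 0)"
    using h_H1[of 0] by (simp add: H1_def weak_deriv_def)
  obtain N1 where N1: "negligible N1" "\<And>x. x \<in> {0..1} - N1 \<Longrightarrow> hx 0 x = h0x x"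
    using weak_deriv_unique[OF _ w, of h0x] h0 by (auto simp: H1_def)
  have "AE x in lebesgue. x \<in> {0..1} \<longrightarrow> v 0 x = v0 x"
    using initial_v by (subst (asm) AE_restrict_space_iff) auto
  then obtain N2 where N2: "negligible N2" "\<And>x. x \<in> {0..1} - N2 \<Longrightarrow> v 0 x = v0 x"
    unfolding eventually_ae_filter_negligible by blast
  have N: "negligible (N1 \<union> N2)" using N1(1) N2(1) by simp
  have eq: "v 0 x = v0 x \<and> h 0 x = h0 x \<and> hx 0 x = h0x x" if "x \<in> {0..1} - (N1 \<union> N2)" for x
    using that N1(2) N2(2) initial_h by blast
  show "E 0 = energy \<sigma> v0 h0 h0x" "S 0 = entropy \<sigma> \<nu> v0 h0 h0x"
    by (rule energy_entropy_cong_AE[OF N eq]; assumption)+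
qed

lemma E_S_nonneg: "\<sigma> > 0 \<Longrightarrow> t \<ge> 0 \<Longrightarrow> E t \<ge> 0" "\<sigma> > 0 \<Longrightarrow> t \<ge> 0 \<Longrightarrow> S t \<ge> 0"
  using energy_entropy_finite h_nonneg by (auto intro!: energy_nonneg entropy_nonneg)

text \<open>The decay lemma applies to \<open>F = E + S\<close>, the two alternatives being whether or not the
  dissipation \<open>D\<close> of the entropy is at most \<open>(M/2)\<^sup>2\<close>. The rate \<open>c\<close> is the largest one with
  \<open>c (9/2 W + (2\<nu>\<^sup>2/M + \<sigma>) D) \<le> \<nu> W + \<nu>\<sigma> D\<close> for all \<open>W, D \<ge> 0\<close>.\<close>

lemma energy_decay:
  fixes M :: real
  assumes pos: "\<sigma> > 0" "\<nu> > 0" "M > 0" and mass: "integral {0..1} h0 = M"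
  defines "c \<equiv> min (2 * \<nu> / 9) (\<nu> * \<sigma> / (2 * \<nu>\<^sup>2 / M + \<sigma>))"
    and "d \<equiv> \<nu> * \<sigma> * (M / 2)\<^sup>2"
  assumes t: "t \<ge> 0"
  shows "E t \<le> (E 0 + S 0) * exp (c / d * S 0) * exp (- c * t)"
proof -
  define W where "W t = integral {0..1} (\<lambda>x. h t x * (vx t x)\<^sup>2)" for t
  define D where "D t = integral {0..1} (\<lambda>x. (hxx t x)\<^sup>2)" for t
  define K where "K = 2 * \<nu>\<^sup>2 / M + \<sigma>"
  have K: "K > 0" unfolding K_def using pos by (intro add_nonneg_pos) auto
  have cd: "c > 0" "d > 0"
    using pos K by (simp_all add: c_def d_def flip: K_def)
  have W: "W t \<ge> 0" if "t > 0" for t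
    unfolding W_def using dissipation_finite[OF that] h_nonneg[of t] that
    by (intro integral_nonneg) (auto simp: absolutely_integrable_on_def)
  have D: "D t \<ge> 0" if "t > 0" for t
    unfolding D_def using hx_H1[OF that]
    by (intro integral_nonneg) (auto simp: H1_def L2_def absolutely_integrable_on_def)
  have "E t + S t \<le> (E 0 + S 0) * exp (c / d * S 0) * exp (- c * t)"
  proof (rule gated_exponential_decay[where F = "\<lambda>t. E t + S t" and S = S
        and F' = "\<lambda>t. - (\<nu> * W t) + - (\<nu> * \<sigma> * D t)" and S' = "\<lambda>t. - (\<nu> * \<sigma> * D t)"])
    show "continuous_on {0..} (\<lambda>t. E t + S t)"
      by (intro continuous_on_add energy_continuous entropy_continuous)
    show "continuous_on {0..} S" by (rule entropy_continuous)
    show "((\<lambda>t. E t + S t) has_real_derivative - (\<nu> * W t) + - (\<nu> * \<sigma> * D t)) (at t)" if "t > 0" for t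
      unfolding W_def D_def by (intro DERIV_add energy_equality entropy_equality that)
    show "(S has_real_derivative - (\<nu> * \<sigma> * D t)) (at t)" if "t > 0" for t
      unfolding D_def by (rule entropy_equality[OF that])
    show "- (\<nu> * W t) + - (\<nu> * \<sigma> * D t) \<le> 0" "- (\<nu> * \<sigma> * D t) \<le> 0" if "t > 0" for t
    proof -
      have "\<nu> * W t \<ge> 0" "\<nu> * \<sigma> * D t \<ge> 0" using W[OF that] D[OF that] pos by simp_all
      then show "- (\<nu> * W t) + - (\<nu> * \<sigma> * D t) \<le> 0" "- (\<nu> * \<sigma> * D t) \<le> 0" by linarith+
    qed
    show "- (\<nu> * W t) + - (\<nu> * \<sigma> * D t) \<le> - c * (E t + S t) \<or> - (\<nu> * \<sigma> * D t) \<le> - d"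
      if t: "t > 0" for t
    proof (cases "D t \<le> (M / 2)\<^sup>2")
      case True
      have "E t + S t \<le> 9 / 2 * W t + K * D t"
        unfolding W_def D_def K_def
        by (rule energy_entropy_le_dissipation)
          (use t pos mass True h_H1[of t] hx_H1[OF t] boundary_h[OF t] boundary_v[OF t] v_cont[OF t]
             v_weak_deriv[OF t] dissipation_finite[OF t] mass_conservation[of t] energy_entropy_finite[of t]
            in \<open>auto simp: H1_def D_def\<close>)
      then have "c * (E t + S t) \<le> c * (9 / 2 * W t + K * D t)"
        using cd by (intro mult_left_mono) auto
      also have "\<dots> = (c * (9 / 2)) * W t + (c * K) * D t" by (simp add: algebra_simps)
      also have "\<dots> \<le> \<nu> * W t + (\<nu> * \<sigma>) * D t"
      proof (intro add_mono mult_right_mono W D t)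
        show "c * (9 / 2) \<le> \<nu>" by (simp add: c_def min_def)
        have "c \<le> \<nu> * \<sigma> / K" by (simp add: c_def K_def)
        then show "c * K \<le> \<nu> * \<sigma>" using K by (simp add: pos_le_divide_eq)
      qed
      finally show ?thesis by simp
    next
      case False
      then have "\<nu> * \<sigma> * (M / 2)\<^sup>2 \<le> \<nu> * \<sigma> * D t" using pos by (intro mult_left_mono) auto
      then show ?thesis by (simp add: d_def)
    qed
    show "E t + S t \<ge> 0" "S t \<ge> 0" if "t \<ge> 0" for t
      using E_S_nonneg[OF pos(1) that] by simp_all
  qed (use cd t in auto)
  then show ?thesis using E_S_nonneg(2)[OF pos(1) t] by linarith
qed

text \<open>Any exponential bound on the energy suffices here. The slope is controlled by the energy at all
  times, hence \<open>h\<close> tends to \<open>M\<close> uniformly; the velocity is controlled once the sheet is thicker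
  than \<open>M/2\<close>, since the kinetic energy carries the weight \<open>h\<close>.\<close>

lemma convergence_to_mean:
  fixes M A B :: real
  assumes pos: "\<sigma> > 0" "M > 0" "B > 0" and mass: "integral {0..1} h0 = M"
    and decay: "\<And>t. t \<ge> 0 \<Longrightarrow> E t \<le> A * exp (- B * t)"
  shows "\<forall>t\<ge>0. integral {0..1} (\<lambda>x. (hx t x)\<^sup>2) \<le> 2 / \<sigma> * A * exp (- B * t)"
    and "((\<lambda>t. H1_norm (\<lambda>x. h t x - M) (hx t)) \<longlongrightarrow> 0) at_top"
    and "\<forall>t\<ge>0. holder (1/2) (h t)"
    and "((\<lambda>t. holder_norm (1/2) (\<lambda>x. h t x - M)) \<longlongrightarrow> 0) at_top"
    and "((\<lambda>t. L2_norm (v t)) \<longlongrightarrow> 0) at_top"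
proof -
  define Q where "Q t = integral {0..1} (\<lambda>x. (hx t x)\<^sup>2)" for t
  have h: "continuous_on {0..1} (h t)" "weak_deriv (h t) (hx t)"
    "(\<lambda>x. (hx t x)\<^sup>2) integrable_on {0..1}" "integral {0..1} (h t) = M" if "t \<ge> 0" for t
    using h_H1[OF that] mass_conservation[OF that] mass
    by (auto simp: H1_def L2_def absolutely_integrable_on_def)
  have Q_nonneg: "Q t \<ge> 0" if "t \<ge> 0" for t
    unfolding Q_def by (intro integral_nonneg h that) auto
  have "LIM t at_top. - B * t :> at_bot"
    by (rule filterlim_tendsto_neg_mult_at_bot[OF tendsto_const _ filterlim_ident]) (use pos in auto)
  then have "((\<lambda>t. A * exp (- B * t)) \<longlongrightarrow> A * 0) at_top"
    by (intro tendsto_mult tendsto_const filterlim_compose[OF exp_at_bot])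
  then have lim0: "((\<lambda>t. A * exp (- B * t)) \<longlongrightarrow> 0) at_top" by simp
  have E_lim: "(E \<longlongrightarrow> 0) at_top"
    by (rule tendsto_sandwich[OF _ _ tendsto_const lim0]; rule eventually_at_top_linorderI[of 0])
      (use E_S_nonneg(1)[OF pos(1)] decay in auto)
  have Q_le: "Q t \<le> 2 / \<sigma> * E t" if "t \<ge> 0" for t
    unfolding Q_def using that pos(1) h_nonneg energy_entropy_finite h(3)
    by (intro energy_controls_slope) auto
  have Q_lim: "(Q \<longlongrightarrow> 0) at_top"
  proof (rule tendsto_sandwich[OF _ _ tendsto_const])
    show "\<forall>\<^sub>F t in at_top. 0 \<le> Q t" "\<forall>\<^sub>F t in at_top. Q t \<le> 2 / \<sigma> * E t"
      using Q_nonneg Q_le by (auto intro: eventually_at_top_linorderI[of 0])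
    show "((\<lambda>t. 2 / \<sigma> * E t) \<longlongrightarrow> 0) at_top"
      by (rule tendsto_mult_right_zero[OF E_lim])
  qed
  show "\<forall>t\<ge>0. integral {0..1} (\<lambda>x. (hx t x)\<^sup>2) \<le> 2 / \<sigma> * A * exp (- B * t)"
  proof (intro allI impI)
    fix t :: real assume "t \<ge> 0"
    then have "2 / \<sigma> * E t \<le> 2 / \<sigma> * (A * exp (- B * t))"
      using decay pos(1) by (intro mult_left_mono) auto
    with Q_le[OF \<open>t \<ge> 0\<close>] show "integral {0..1} (\<lambda>x. (hx t x)\<^sup>2) \<le> 2 / \<sigma> * A * exp (- B * t)"
      by (simp add: Q_def)
  qed
  show "((\<lambda>t. H1_norm (\<lambda>x. h t x - M) (hx t)) \<longlongrightarrow> 0) at_top"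
  proof (rule tendsto_sandwich[OF _ _ tendsto_const])
    show "\<forall>\<^sub>F t in at_top. 0 \<le> H1_norm (\<lambda>x. h t x - M) (hx t)"
      by (simp add: H1_norm_def)
    show "\<forall>\<^sub>F t in at_top. H1_norm (\<lambda>x. h t x - M) (hx t) \<le> sqrt (2 * Q t)"
      using H1_norm_deviation_le[OF h] by (auto intro!: eventually_at_top_linorderI[of 0] simp: Q_def)
    show "((\<lambda>t. sqrt (2 * Q t)) \<longlongrightarrow> 0) at_top"
      using tendsto_real_sqrt[OF tendsto_mult_right_zero[OF Q_lim]] by simp
  qed
  show "\<forall>t\<ge>0. holder (1/2) (h t)"
    using holder_half_bounds(1)[OF h] by blast
  show "((\<lambda>t. holder_norm (1/2) (\<lambda>x. h t x - M)) \<longlongrightarrow> 0) at_top"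
  proof (rule tendsto_sandwich[OF _ _ tendsto_const])
    show "\<forall>\<^sub>F t in at_top. 0 \<le> holder_norm (1/2) (\<lambda>x. h t x - M)"
      using holder_half_bounds(2)[OF h] by (auto intro!: eventually_at_top_linorderI[of 0])
    show "\<forall>\<^sub>F t in at_top. holder_norm (1/2) (\<lambda>x. h t x - M) \<le> 2 * sqrt (Q t)"
      using holder_half_bounds(3)[OF h] by (auto intro!: eventually_at_top_linorderI[of 0] simp: Q_def)
    show "((\<lambda>t. 2 * sqrt (Q t)) \<longlongrightarrow> 0) at_top"
      by (rule tendsto_mult_right_zero) (use tendsto_real_sqrt[OF Q_lim] in simp)
  qed
  show "((\<lambda>t. L2_norm (v t)) \<longlongrightarrow> 0) at_top"
  proof (rule tendsto_sandwich[OF _ _ tendsto_const])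
    show "\<forall>\<^sub>F t in at_top. 0 \<le> L2_norm (v t)"
    proof (rule eventually_at_top_linorderI[of 0])
      fix t :: real assume "t \<ge> 0"
      then have "integral {0..1} (\<lambda>x. (v t x)\<^sup>2) \<ge> 0"
        using v_L2 by (intro integral_nonneg) (auto simp: L2_def absolutely_integrable_on_def)
      then show "0 \<le> L2_norm (v t)" by (simp add: L2_norm_def)
    qed
    have "\<forall>\<^sub>F t in at_top. Q t < (M / 2)\<^sup>2"
      using Q_lim by (rule order_tendstoD) (use pos in auto)
    then show "\<forall>\<^sub>F t in at_top. L2_norm (v t) \<le> sqrt (2 / (M / 2) * E t)"
      using eventually_ge_at_top[of 0]
    proof eventually_elim
      case (elim t)
      have "h t x \<ge> M / 2" if "x \<in> {0..1}" for x
      proof -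
        have "\<bar>h t x - M\<bar> \<le> sqrt (Q t)"
          using deviation_from_mean[OF h(1)[OF elim(2)] h(4)[OF elim(2)] _ that]
            weak_deriv_oscillation[OF h(1-3)[OF elim(2)]] unfolding Q_def by blast
        also have "\<dots> \<le> M / 2" using elim(1) pos by (intro real_le_lsqrt) auto
        finally show ?thesis by linarith
      qed
      then show ?case
        using pos elim(2) energy_entropy_finite[OF elim(2)] v_L2[OF elim(2)]
        by (intro energy_controls_velocity) (auto simp: L2_def absolutely_integrable_on_def)
    qed
    show "((\<lambda>t. sqrt (2 / (M / 2) * E t)) \<longlongrightarrow> 0) at_top"
      using tendsto_real_sqrt[OF tendsto_mult_right_zero[OF E_lim, of "2 / (M / 2)"]] by simp
  qed
qed

end

theorem theorem2p1:
  fixes \<sigma> \<nu> M :: real and h0 h0x v0 :: "real \<Rightarrow> real"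
  assumes "\<sigma> > 0" and "\<nu> > 0"
    and "H1 h0 h0x" and "L2 v0"
    and "\<And>x. x \<in> {0..1} \<Longrightarrow> h0 x \<ge> 0"
    and "M = integral {0..1} h0" and "M > 0"
    and "finite_energy_entropy \<sigma> \<nu> v0 h0 h0x"
  shows "\<exists>A B. A > 0 \<and> B > 0 \<and>
    (\<forall>h hx hxx v vx. viscous_sheet_solution \<sigma> \<nu> h0 v0 h hx hxx v vx \<longrightarrow>
       (\<forall>t\<ge>0. integral {0..1} (\<lambda>x. (hx t x)\<^sup>2) \<le> A * exp (- B * t)) \<and>
       ((\<lambda>t. H1_norm (\<lambda>x. h t x - M) (hx t)) \<longlongrightarrow> 0) at_top \<and>
       (\<forall>t\<ge>0. holder (1/2) (h t)) \<and>
       ((\<lambda>t. holder_norm (1/2) (\<lambda>x. h t x - M)) \<longlongrightarrow> 0) at_top \<and>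
       ((\<lambda>t. L2_norm (v t)) \<longlongrightarrow> 0) at_top)"
proof -
  define E0 S0 where "E0 = energy \<sigma> v0 h0 h0x" and "S0 = entropy \<sigma> \<nu> v0 h0 h0x"
  define B where "B = min (2 * \<nu> / 9) (\<nu> * \<sigma> / (2 * \<nu>\<^sup>2 / M + \<sigma>))"
  define d where "d = \<nu> * \<sigma> * (M / 2)\<^sup>2"
  define A where "A = (E0 + S0) * exp (B / d * S0)"
  have "2 * \<nu>\<^sup>2 / M + \<sigma> > 0" using assms by (intro add_nonneg_pos) auto
  then have B: "B > 0" using assms by (simp add: B_def)
  have "E0 \<ge> 0" "S0 \<ge> 0"
    using assms by (auto simp: E0_def S0_def intro: energy_nonneg entropy_nonneg)
  then have A: "A \<ge> 0" by (simp add: A_def)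
  show ?thesis
  proof (rule exI[of _ "2 / \<sigma> * A + 1"], rule exI[of _ B], intro conjI allI impI)
    \<comment> \<open>The summand \<open>1\<close> keeps the constant positive when the initial energy and entropy are zero.\<close>
    show "2 / \<sigma> * A + 1 > 0" using A assms(1) by (intro add_nonneg_pos) auto
    show "B > 0" by (fact B)
    fix h hx hxx v vx
    assume "viscous_sheet_solution \<sigma> \<nu> h0 v0 h hx hxx v vx"
    then interpret viscous_sheet_solution \<sigma> \<nu> h0 v0 h hx hxx v vx .
    have "energy \<sigma> (v t) (h t) (hx t) \<le> A * exp (- B * t)" if "t \<ge> 0" for t
      using energy_decay[OF assms(1,2,7) assms(6)[symmetric] that] initial_energy_entropy[OF assms(3)]
      by (simp add: A_def E0_def S0_def B_def d_def)
    note conv = convergence_to_mean[OF assms(1,7) B assms(6)[symmetric] this]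
    show "((\<lambda>t. H1_norm (\<lambda>x. h t x - M) (hx t)) \<longlongrightarrow> 0) at_top"
      by (rule conv(2))
    show "((\<lambda>t. holder_norm (1/2) (\<lambda>x. h t x - M)) \<longlongrightarrow> 0) at_top"
      by (rule conv(4))
    show "((\<lambda>t. L2_norm (v t)) \<longlongrightarrow> 0) at_top"
      by (rule conv(5))
    fix t :: real assume t: "t \<ge> 0"
    then show "holder (1/2) (h t)" using conv(3) by blast
    have "integral {0..1} (\<lambda>x. (hx t x)\<^sup>2) \<le> 2 / \<sigma> * A * exp (- B * t)"
      using conv(1) t by blast
    also have "\<dots> \<le> (2 / \<sigma> * A + 1) * exp (- B * t)"
      by (intro mult_right_mono) auto
    finally show "integral {0..1} (\<lambda>x. (hx t x)\<^sup>2) \<le> (2 / \<sigma> * A + 1) * exp (- B * t)" .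
  qed
qed

end
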